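(* Consider a stable Phase 2 of the Extending Window Method (setting below). For $b\in\mathcal{B}$ and $m\ge1$ write $\mathcal{Q}_{[b^m]}:=\mathcal{Q}_{[b,\dots,b]}$ with $m$ copies of $b$. If $m_0\ge2$ and $b\in\mathcal{B}$ are such that $\#\mathcal{Q}_{[b^{m_0}]}=\#\mathcal{Q}_{[b^{m_0-1}]}$, then $\#\mathcal{Q}_{[b^m]}=\#\mathcal{Q}_{[b^{m_0}]}$ for every $m\ge m_0-1$. In particular, if $\#\mathcal{Q}_{[b^{m_0}]}\ge2$, then Phase 2 does not converge.
   Context: Setting: $\beta$ an algebraic integer, $\mathcal{A}\subset\mathbb{Z}[\beta]$ a finite alphabet, $\mathcal{B}\subset\mathbb{Z}[\beta]$ a finite input alphabet with $\mathcal{A}\subsetneq\mathcal{B}\subset\mathcal{A}+\mathcal{A}$, and $\mathcal{Q}\subset\mathbb{Z}[\beta]$ a finite set with $0\in\mathcal{Q}$ and $\mathcal{B}+\mathcal{Q}\subset\mathcal{A}+\beta\mathcal{Q}$. Phase 2 chooses, for each $n\ge1$ and $(x_1,\dots,x_n)\in\mathcal{B}^n$, a set $\mathcal{Q}_{[x_1,\dots,x_n]}\subset\mathcal{Q}$ with $x_1+\mathcal{Q}\subset\mathcal{A}+\beta\mathcal{Q}_{[x_1]}$, and for $n\ge2$, $\mathcal{Q}_{[x_1,\dots,x_n]}\subset\mathcal{Q}_{[x_1,\dots,x_{n-1}]}$ and $x_1+\mathcal{Q}_{[x_2,\dots,x_n]}\subset\mathcal{A}+\beta\mathcal{Q}_{[x_1,\dots,x_n]}$.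 Phase 2 converges if there is $n$ with $\#\mathcal{Q}_{[x_1,\dots,x_n]}=1$ for all $(x_1,\dots,x_n)\in\mathcal{B}^n$. Phase 2 is stable if for all $k\ge2$ and all $(x_1,\dots,x_{k+1})\in\mathcal{B}^{k+1}$: $\mathcal{Q}_{[x_2,\dots,x_{k+1}]}=\mathcal{Q}_{[x_2,\dots,x_k]}$ implies $\mathcal{Q}_{[x_1,\dots,x_{k+1}]}=\mathcal{Q}_{[x_1,\dots,x_k]}$. *)

theory Defs
  imports
    Complex_Main
    "HOL-Library.Set_Algebras"
    "HOL-Computational_Algebra.Polynomial"
begin

definition int_adjoin :: "complex \<Rightarrow> complex set" where
  "int_adjoin \<beta> = range (\<lambda>p :: int poly. poly (map_poly of_int p) \<beta>)"

definition words :: "nat \<Rightarrow> complex set \<Rightarrow> complex list set" where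
  "words n B = {xs. length xs = n \<and> set xs \<subseteq> B}"

locale ewm_setting =
  fixes \<beta> :: complex and A B Q :: "complex set"
  assumes base_algebraic_int: "algebraic_int \<beta>"
    and alphabet_finite: "finite A"
    and alphabet_subset: "A \<subseteq> int_adjoin \<beta>"
    and input_finite: "finite B"
    and input_subset: "B \<subseteq> int_adjoin \<beta>"
    and alphabet_psubset_input: "A \<subset> B"
    and input_subset_sum: "B \<subseteq> A + A"
    and coeffs_finite: "finite Q"
    and coeffs_subset: "Q \<subseteq> int_adjoin \<beta>"
    and zero_in_coeffs: "0 \<in> Q"
    and coeffs_closed: "B + Q \<subseteq> A + \<beta> *o Q"

text \<open>
  The value \<open>W [x\<^sub>1, \<dots>, x\<^sub>n]\<close> is the set of weight coefficients chosen for the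
  window \<open>(x\<^sub>1, \<dots>, x\<^sub>n)\<close>; only its values on nonempty words over \<open>B\<close> matter.
  For \<open>n \<ge> 2\<close> and \<open>xs = [x\<^sub>1, \<dots>, x\<^sub>n]\<close>, the list \<open>butlast xs\<close> is
  \<open>[x\<^sub>1, \<dots>, x\<^sub>n\<^sub>-\<^sub>1]\<close> and \<open>tl xs\<close> is \<open>[x\<^sub>2, \<dots>, x\<^sub>n]\<close>.
\<close>

locale ewm_phase2 = ewm_setting +
  fixes W :: "complex list \<Rightarrow> complex set"
  assumes phase2_subset: "\<And>n xs. n \<ge> 1 \<Longrightarrow> xs \<in> words n B \<Longrightarrow> W xs \<subseteq> Q"
    and phase2_start: "\<And>x. x \<in> B \<Longrightarrow> x +o Q \<subseteq> A + \<beta> *o W [x]"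
    and phase2_decreasing:
      "\<And>n xs. n \<ge> 2 \<Longrightarrow> xs \<in> words n B \<Longrightarrow> W xs \<subseteq> W (butlast xs)"
    and phase2_step:
      "\<And>n xs. n \<ge> 2 \<Longrightarrow> xs \<in> words n B \<Longrightarrow> hd xs +o W (tl xs) \<subseteq> A + \<beta> *o W xs"

definition phase2_converges ::
    "complex set \<Rightarrow> (complex list \<Rightarrow> complex set) \<Rightarrow> bool" where
  "phase2_converges B W \<longleftrightarrow> (\<exists>n\<ge>1. \<forall>xs\<in>words n B. card (W xs) = 1)"

definition phase2_stable ::
    "complex set \<Rightarrow> (complex list \<Rightarrow> complex set) \<Rightarrow> bool" where
  "phase2_stable B W \<longleftrightarrow>
    (\<forall>k\<ge>2. \<forall>xs\<in>words (k + 1) B.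
       W (tl xs) = W (butlast (tl xs)) \<longrightarrow> W xs = W (butlast xs))"

end

theory Submission
  imports Defs
begin

text \<open>Along the words b, bb, bbb, ... the coefficient sets form a decreasing chain of finite
  sets (\<open>W_replicate_antimono\<close>, \<open>finite_W\<close>), so two consecutive members of
  equal cardinality are equal. Removing the first or the last letter of a constant word gives the
  same word, so stability says that one equality of neighbours in the chain forces the next
  (\<open>stable_W_replicate_Suc\<close>). By induction the chain is constant from there on
  (\<open>stable_W_replicate_const\<close>). If the constant set has at least two elements, then so
  does every earlier set of the chain, and no window length can give singletons for all
  words.\<close>

lemma replicate_in_words: "b \<in> B \<Longrightarrow> replicate n b \<in> words n B"
  by (auto simp: words_def)

context ewm_phase2
begin

lemma finite_W: "n \<ge> 1 \<Longrightarrow> xs \<in> words n B \<Longrightarrow> finite (W xs)"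
  using phase2_subset coeffs_finite finite_subset by blast

lemma W_replicate_Suc_subset:
  assumes "b \<in> B" and "n \<ge> 1"
  shows "W (replicate (Suc n) b) \<subseteq> W (replicate n b)"
  using phase2_decreasing[OF _ replicate_in_words[OF assms(1)], of "Suc n"] assms(2)
  by (simp add: butlast_conv_take min_def flip: replicate_Suc)

lemma W_replicate_antimono:
  assumes "b \<in> B" and "1 \<le> n" and "n \<le> m"
  shows "W (replicate m b) \<subseteq> W (replicate n b)"
  using assms(3)
proof (induction m rule: dec_induct)
  case (step m)
  then show ?case
    using W_replicate_Suc_subset[OF assms(1), of m] assms(2) by auto
qed simp

text \<open>This is stability for the word of k + 1 copies of b: its \<open>tl\<close> and its
  \<open>butlast\<close> are both the word of k copies, so the conclusion has the shape of the
  premise with k raised by one.\<close>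

lemma stable_W_replicate_Suc:
  assumes "phase2_stable B W" and "b \<in> B" and "k \<ge> 2"
    and "W (replicate k b) = W (replicate (k - 1) b)"
  shows "W (replicate (Suc k) b) = W (replicate k b)"
proof -
  have "replicate (Suc k) b \<in> words (k + 1) B"
    using replicate_in_words[OF assms(2), of "Suc k"] by simp
  moreover have "butlast (replicate (Suc k) b) = replicate k b"
    and "butlast (replicate k b) = replicate (k - 1) b"
    by (simp_all add: butlast_conv_take min_def del: replicate_Suc)
  moreover have "tl (replicate (Suc k) b) = replicate k b"
    by simp
  ultimately show ?thesis
    using assms(1,3,4) unfolding phase2_stable_def by metis
qed

lemma stable_W_replicate_const:
  assumes "phase2_stable B W" and "b \<in> B" and "k \<ge> 2"
    and "W (replicate k b) = W (replicate (k - 1) b)" and "m \<ge> k - 1"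
  shows "W (replicate m b) = W (replicate k b)"
proof -
  \<comment> \<open>The first conjunct strengthens the induction: the equality of neighbours at m is
    what stability needs to pass to m + 1.\<close>
  have const: "W (replicate m b) = W (replicate (m - 1) b)
      \<and> W (replicate m b) = W (replicate k b)" if "k \<le> m" for m
    using that
  proof (induction m rule: dec_induct)
    case base
    show ?case using assms(4) by simp
  next
    case (step m)
    then have "W (replicate (Suc m) b) = W (replicate m b)"
      using stable_W_replicate_Suc[OF assms(1,2), of m] assms(3) by simp
    then show ?case
      using step.IH by (metis diff_Suc_1)
  qed
  show ?thesis
  proof (cases "k \<le> m")
    case False
    then have "m = k - 1" using assms(5) by simp
    then show ?thesis using assms(4) by simp
  qed (use const in blast)
qed

end

theorem theorem19:
  fixes \<beta> b :: complex
    and A B Q :: "complex set"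
    and W :: "complex list \<Rightarrow> complex set"
    and m\<^sub>0 :: nat
  assumes "ewm_phase2 \<beta> A B Q W"
    and "phase2_stable B W"
    and "m\<^sub>0 \<ge> 2"
    and "b \<in> B"
    and "card (W (replicate m\<^sub>0 b)) = card (W (replicate (m\<^sub>0 - 1) b))"
  shows "(\<forall>m\<ge>m\<^sub>0 - 1. card (W (replicate m b)) = card (W (replicate m\<^sub>0 b))) \<and>
    (card (W (replicate m\<^sub>0 b)) \<ge> 2 \<longrightarrow> \<not> phase2_converges B W)"
proof -
  interpret ewm_phase2 \<beta> A B Q W by fact
  have fin: "finite (W (replicate n b))" if "n \<ge> 1" for n
    using finite_W[OF that replicate_in_words[OF assms(4)]] .
  \<comment> \<open>Inclusion between finite sets of equal cardinality is equality. Since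
    \<open>m\<^sub>0 \<ge> 2\<close>, the shorter word is nonempty, so \<open>W\<close> is known to
    be finite there.\<close>
  have "W (replicate m\<^sub>0 b) = W (replicate (m\<^sub>0 - 1) b)"
    using assms(3,5) by (intro card_subset_eq fin W_replicate_antimono[OF assms(4)]) auto
  then have const: "W (replicate m b) = W (replicate m\<^sub>0 b)" if "m \<ge> m\<^sub>0 - 1" for m
    using stable_W_replicate_const[OF assms(2,4,3)] that by blast
  have "\<not> phase2_converges B W" if "card (W (replicate m\<^sub>0 b)) \<ge> 2"
  proof
    assume "phase2_converges B W"
    then obtain n where n: "n \<ge> 1" and "card (W (replicate n b)) = 1"
      unfolding phase2_converges_def using replicate_in_words[OF assms(4)] by blast
    \<comment> \<open>A window length n witnessing convergence may lie on either side of
      \<open>m\<^sub>0\<close>: up to \<open>m\<^sub>0\<close> the chain is decreasing, and beyond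
      it the chain is constant.\<close>
    moreover have "card (W (replicate m\<^sub>0 b)) \<le> card (W (replicate n b))"
    proof (cases "n \<le> m\<^sub>0")
      case True
      then show ?thesis
        by (intro card_mono fin W_replicate_antimono assms(4) n)
    next
      case False
      then show ?thesis using const[of n] by simp
    qed
    ultimately show False using that by simp
  qed
  moreover have "\<forall>m\<ge>m\<^sub>0 - 1. card (W (replicate m b)) = card (W (replicate m\<^sub>0 b))"
    by (intro allI impI arg_cong[where f = card] const)
  ultimately show ?thesis by blast
qed

end
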